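(* Let $X$ be a topological space and $x_0\in X$. Then $X$ is an SLT space at $x_0$ if and only if for every open neighborhood $U\subseteq X$ of $x_0$ there is a path open cover $\mathcal{V}$ of $X$ at $x_0$ such that $\widetilde{\pi}(\mathcal{V},x_0)\leq i_*\pi_1(U,x_0)$, where $i_*:\pi_1(U,x_0)\to\pi_1(X,x_0)$ is the homomorphism induced by the inclusion $i:U\to X$.
   Context: Let $I=[0,1]$; $P(X,x_0)$ denotes the set of paths $\alpha:I\to X$ with $\alpha(0)=x_0$; $\ast$ denotes concatenation and $\alpha^{-1}$ the reversed path. A path $\alpha:I\to X$ is an SLT (small loop transfer) path if for every open neighborhood $U$ of $\alpha(0)$ in $X$ there is an open neighborhood $V$ of $\alpha(1)$ in $X$ such that for every loop $\gamma$ in $V$ based at $\alpha(1)$ there is a loop $\gamma'$ in $U$ based at $\alpha(0)$ which is homotopic in $X$, relative to $\{0,1\}$, to $\alpha\ast\gamma\ast\alpha^{-1}$. The space $X$ is SLT at $x_0$ if every path in $X$ starting at $x_0$ is an SLT path. A path open cover of $X$ at $x_0$ is a family $\mathcal{V}=\{V_\alpha \mid \alpha\in P(X,x_0)\}$ of open subsets of $X$ with $\alpha(1)\in V_\alpha$ for every $\alpha\in P(X,x_0)$. The path Spanier group $\widetilde{\pi}(\mathcal{V},x_0)$ is the subgroup of $\pi_1(X,x_0)$ consisting of homotopy classes of loops that can be represented by a concatenation $\prod_{j=1}^{n}\alpha_j\beta_j\alpha_j^{-1}$, where each $\alpha_j$ is an arbitrary path starting at $x_0$ and each $\beta_j$ is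 a loop based at $\alpha_j(1)$ lying inside $V_{\alpha_j}$. *)

theory Defs
  imports "HOL-Analysis.Analysis" "HOL-Algebra.Group"
begin

text \<open>
  A topological space is a set \<open>X\<close> in a type of class \<open>topological_space\<close>, with the subspace
  topology \<open>top_of_set X\<close>; paths, their concatenation \<open>+++\<close>, their reversal and homotopy relative
  to \<open>{0,1}\<close> in \<open>X\<close> (\<open>homotopic_paths X\<close>) are those of the library.
\<close>

section \<open>The fundamental group\<close>

definition loops_at :: "'a::topological_space set \<Rightarrow> 'a \<Rightarrow> (real \<Rightarrow> 'a) set" where
  "loops_at X x =
     {p. path p \<and> path_image p \<subseteq> X \<and> pathstart p = x \<and> pathfinish p = x}"

definition loop_rel :: "'a::topological_space set \<Rightarrow> 'a \<Rightarrow> ((real \<Rightarrow> 'a) \<times> (real \<Rightarrow> 'a)) set" where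
  "loop_rel X x = {(p, q). p \<in> loops_at X x \<and> q \<in> loops_at X x \<and> homotopic_paths X p q}"

definition loop_class :: "'a::topological_space set \<Rightarrow> 'a \<Rightarrow> (real \<Rightarrow> 'a) \<Rightarrow> (real \<Rightarrow> 'a) set" where
  "loop_class X x p = loop_rel X x `` {p}"

text \<open>
  The unions below are unions of equal classes; see \<open>pi1_mult_class\<close> and \<open>pi1_map_class\<close>.
\<close>

definition pi1 :: "'a::topological_space set \<Rightarrow> 'a \<Rightarrow> (real \<Rightarrow> 'a) set monoid" where
  "pi1 X x = \<lparr>carrier = loops_at X x // loop_rel X x,
              mult = (\<lambda>c d. \<Union>p\<in>c. \<Union>q\<in>d. loop_class X x (p +++ q)),
              one = loop_class X x (\<lambda>_. x)\<rparr>"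

text \<open>\<open>pi1_map f Y y\<close> is the homomorphism into \<open>pi1 Y y\<close> induced by \<open>f\<close>, where \<open>y\<close> is the image
  under \<open>f\<close> of the base point of the source.\<close>

definition pi1_map ::
    "('a::topological_space \<Rightarrow> 'b::topological_space) \<Rightarrow> 'b set \<Rightarrow> 'b
      \<Rightarrow> (real \<Rightarrow> 'a) set \<Rightarrow> (real \<Rightarrow> 'b) set" where
  "pi1_map f Y y c = (\<Union>p\<in>c. loop_class Y y (f \<circ> p))"


section \<open>SLT spaces and path Spanier groups\<close>

text \<open>Library paths are functions on all of \<open>real\<close>. Extensionality identifies paths that agree on
  \<open>{0..1}\<close>, so that a family indexed by \<open>paths_from X x\<close> is indexed by maps on \<open>{0..1}\<close>.\<close>

definition paths_from :: "'a::topological_space set \<Rightarrow> 'a \<Rightarrow> (real \<Rightarrow> 'a) set" where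
  "paths_from X x =
     {\<alpha> \<in> extensional {0..1}. path \<alpha> \<and> path_image \<alpha> \<subseteq> X \<and> pathstart \<alpha> = x}"

definition SLT_path :: "'a::topological_space set \<Rightarrow> (real \<Rightarrow> 'a) \<Rightarrow> bool" where
  "SLT_path X \<alpha> \<longleftrightarrow> path \<alpha> \<and> path_image \<alpha> \<subseteq> X \<and>
     (\<forall>U. openin (top_of_set X) U \<and> pathstart \<alpha> \<in> U \<longrightarrow>
       (\<exists>V. openin (top_of_set X) V \<and> pathfinish \<alpha> \<in> V \<and>
         (\<forall>\<gamma> \<in> loops_at V (pathfinish \<alpha>). \<exists>\<gamma>' \<in> loops_at U (pathstart \<alpha>).
            homotopic_paths X \<gamma>' (\<alpha> +++ \<gamma> +++ reversepath \<alpha>))))"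

definition SLT_at :: "'a::topological_space set \<Rightarrow> 'a \<Rightarrow> bool" where
  "SLT_at X x \<longleftrightarrow> (\<forall>\<alpha> \<in> paths_from X x. SLT_path X \<alpha>)"

definition path_open_cover ::
    "'a::topological_space set \<Rightarrow> 'a \<Rightarrow> ((real \<Rightarrow> 'a) \<Rightarrow> 'a set) \<Rightarrow> bool" where
  "path_open_cover X x V \<longleftrightarrow>
     (\<forall>\<alpha> \<in> paths_from X x. openin (top_of_set X) (V \<alpha>) \<and> pathfinish \<alpha> \<in> V \<alpha>)"

text \<open>The concatenation over \<open>j = 1, \<dots>, n\<close> of \<open>\<alpha>\<^sub>j +++ \<beta>\<^sub>j +++ reversepath \<alpha>\<^sub>j\<close> for a list of pairs
  \<open>(\<alpha>\<^sub>j, \<beta>\<^sub>j)\<close>, bracketed to the right and closed off with the constant loop, which is also the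
  value of the empty concatenation.\<close>

definition conj_loops :: "'a::topological_space \<Rightarrow> ((real \<Rightarrow> 'a) \<times> (real \<Rightarrow> 'a)) list \<Rightarrow> real \<Rightarrow> 'a" where
  "conj_loops x ps = foldr (\<lambda>(\<alpha>, \<beta>) p. (\<alpha> +++ \<beta> +++ reversepath \<alpha>) +++ p) ps (\<lambda>_. x)"

definition path_spanier ::
    "'a::topological_space set \<Rightarrow> 'a \<Rightarrow> ((real \<Rightarrow> 'a) \<Rightarrow> 'a set) \<Rightarrow> (real \<Rightarrow> 'a) set set" where
  "path_spanier X x V =
     {loop_class X x (conj_loops x ps) |ps.
        \<forall>(\<alpha>, \<beta>) \<in> set ps. \<alpha> \<in> paths_from X x \<and> \<beta> \<in> loops_at (V \<alpha>) (pathfinish \<alpha>)}"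


section \<open>The fundamental group is a group and the path Spanier group is a subgroup\<close>

lemma path_const: "path (\<lambda>_. x)"
  by (simp add: path_def)

lemma const_in_loops_at: "x \<in> X \<Longrightarrow> (\<lambda>_. x) \<in> loops_at X x"
  by (auto simp: loops_at_def path_const path_image_def pathstart_def pathfinish_def)

lemma join_in_loops_at: "p \<in> loops_at X x \<Longrightarrow> q \<in> loops_at X x \<Longrightarrow> p +++ q \<in> loops_at X x"
  by (simp add: loops_at_def subset_path_image_join path_join_imp)

lemma reverse_in_loops_at: "p \<in> loops_at X x \<Longrightarrow> reversepath p \<in> loops_at X x"
  by (auto simp: loops_at_def)

lemma loops_at_base: "p \<in> loops_at X x \<Longrightarrow> x \<in> X"
  by (auto simp: loops_at_def pathstart_def path_image_def)

lemma homotopic_paths_rid_const: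
  fixes p :: "real \<Rightarrow> 'a::topological_space"
  assumes "path p" "path_image p \<subseteq> S" "pathfinish p = x"
  shows "homotopic_paths S (p +++ (\<lambda>_. x)) p"
proof -
  have c: "continuous_on {0..1} (\<lambda>t::real. min 1 (2 * t))"
    by (intro continuous_intros)
  have "homotopic_paths S p (p +++ (\<lambda>_. x))"
  proof (rule homotopic_paths_reparametrize[OF assms(1,2) c])
    show "(p +++ (\<lambda>_. x)) t = p (min 1 (2 * t))" for t
      using assms(3) by (cases "t \<le> 1/2") (simp_all add: joinpaths_def pathfinish_def min_absorb1 min_absorb2)
  qed auto
  then show ?thesis
    by (rule homotopic_paths_sym)
qed

lemma homotopic_paths_lid_const:
  fixes p :: "real \<Rightarrow> 'a::topological_space"
  assumes "path p" "path_image p \<subseteq> S" "pathstart p = x"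
  shows "homotopic_paths S ((\<lambda>_. x) +++ p) p"
proof -
  have c: "continuous_on {0..1} (\<lambda>t::real. max 0 (2 * t - 1))"
    by (intro continuous_intros)
  have "homotopic_paths S p ((\<lambda>_. x) +++ p)"
  proof (rule homotopic_paths_reparametrize[OF assms(1,2) c])
    show "((\<lambda>_. x) +++ p) t = p (max 0 (2 * t - 1))" for t
      using assms(3) by (cases "t \<le> 1/2") (simp_all add: joinpaths_def pathstart_def max_absorb1 max_absorb2)
  qed auto
  then show ?thesis
    by (rule homotopic_paths_sym)
qed

lemma homotopic_paths_rinv_const:
  fixes p :: "real \<Rightarrow> 'a::topological_space"
  assumes "path p" "path_image p \<subseteq> S" "pathstart p = x"
  shows "homotopic_paths S (p +++ reversepath p) (\<lambda>_. x)"
proof -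
  define g :: "real \<times> real \<Rightarrow> real" where "g = (\<lambda>(s, t). (1 - s) * (1 - \<bar>2 * t - 1\<bar>))"
  have g: "continuous_on ({0..1} \<times> {0..1}) g"
    unfolding g_def case_prod_unfold by (intro continuous_intros)
  have g01: "g \<in> {0..1} \<times> {0..1} \<rightarrow> {0..1}"
    by (auto simp: g_def intro!: mult_nonneg_nonneg mult_le_one)
  have p: "continuous_on {0..1} p"
    using assms(1) by (simp add: path_def)
  have "continuous_on ({0..1} \<times> {0..1}) (p \<circ> g)"
    using g01 by (intro continuous_on_compose g continuous_on_subset[OF p]) auto
  moreover have "p \<circ> g \<in> {0..1} \<times> {0..1} \<rightarrow> S"
    using g01 assms(2) by (fastforce simp: path_image_def)
  moreover have "(p \<circ> g) (0, t) = (p +++ reversepath p) t" if "t \<in> {0..1}" for t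
    using that by (auto simp: g_def joinpaths_def reversepath_def abs_if algebra_simps)
  ultimately show ?thesis
    unfolding homotopic_paths using assms(3)
    by (intro exI[of _ "p \<circ> g"])
       (auto simp: g_def pathstart_def pathfinish_def joinpaths_def reversepath_def)
qed

lemma equiv_loop_rel: "equiv (loops_at X x) (loop_rel X x)"
proof (rule equivI)
  show "loop_rel X x \<subseteq> loops_at X x \<times> loops_at X x"
    by (auto simp: loop_rel_def)
  show "refl_on (loops_at X x) (loop_rel X x)"
    by (auto simp: refl_on_def loop_rel_def loops_at_def)
  show "sym (loop_rel X x)"
    by (auto simp: sym_def loop_rel_def intro: homotopic_paths_sym)
  show "trans (loop_rel X x)"
    by (auto simp: trans_def loop_rel_def intro: homotopic_paths_trans)
qed

lemma loop_class_eq_iff: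
  assumes "p \<in> loops_at X x" "q \<in> loops_at X x"
  shows "loop_class X x p = loop_class X x q \<longleftrightarrow> homotopic_paths X p q"
  unfolding loop_class_def using eq_equiv_class_iff[OF equiv_loop_rel assms] assms
  by (simp add: loop_rel_def)

lemma mem_loop_class:
  assumes "p \<in> loops_at X x"
  shows "q \<in> loop_class X x p \<longleftrightarrow> q \<in> loops_at X x \<and> homotopic_paths X p q"
  using assms by (simp add: loop_class_def loop_rel_def)

lemma loop_class_self: "p \<in> loops_at X x \<Longrightarrow> p \<in> loop_class X x p"
  by (simp add: mem_loop_class) (simp add: loops_at_def)

lemma carrier_pi1: "carrier (pi1 X x) = loop_class X x ` loops_at X x"
  by (auto simp: pi1_def quotient_def loop_class_def)

lemma one_pi1: "\<one>\<^bsub>pi1 X x\<^esub> = loop_class X x (\<lambda>_. x)"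
  by (simp add: pi1_def)

lemma pi1_mult_class:
  assumes p: "p \<in> loops_at X x" and q: "q \<in> loops_at X x"
  shows "loop_class X x p \<otimes>\<^bsub>pi1 X x\<^esub> loop_class X x q = loop_class X x (p +++ q)"
proof -
  have "loop_class X x (p' +++ q') = loop_class X x (p +++ q)"
    if "p' \<in> loop_class X x p" "q' \<in> loop_class X x q" for p' q'
  proof -
    have "p' \<in> loops_at X x" "q' \<in> loops_at X x" "homotopic_paths X p' p" "homotopic_paths X q' q"
      using that p q by (auto simp: mem_loop_class intro: homotopic_paths_sym)
    moreover from this have "homotopic_paths X (p' +++ q') (p +++ q)"
      by (intro homotopic_paths_join) (auto simp: loops_at_def)
    ultimately show ?thesis
      using p q by (simp add: loop_class_eq_iff join_in_loops_at)
  qed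
  then have "(\<Union>p'\<in>loop_class X x p. \<Union>q'\<in>loop_class X x q. loop_class X x (p' +++ q'))
      = loop_class X x (p +++ q)"
    by (intro UN_constant_eq[OF loop_class_self[OF p]] UN_constant_eq[OF loop_class_self[OF q]] ballI)
  then show ?thesis
    by (simp add: pi1_def)
qed

lemma group_pi1:
  assumes "x \<in> X"
  shows "group (pi1 X x)"
proof (rule groupI)
  fix a b assume "a \<in> carrier (pi1 X x)" "b \<in> carrier (pi1 X x)"
  then show "a \<otimes>\<^bsub>pi1 X x\<^esub> b \<in> carrier (pi1 X x)"
    by (auto simp: carrier_pi1 pi1_mult_class join_in_loops_at)
next
  show "\<one>\<^bsub>pi1 X x\<^esub> \<in> carrier (pi1 X x)"
    using assms by (simp add: carrier_pi1 one_pi1 const_in_loops_at)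
next
  fix a b c
  assume "a \<in> carrier (pi1 X x)" "b \<in> carrier (pi1 X x)" "c \<in> carrier (pi1 X x)"
  then obtain p q r where pqr: "p \<in> loops_at X x" "q \<in> loops_at X x" "r \<in> loops_at X x"
    and eq: "a = loop_class X x p" "b = loop_class X x q" "c = loop_class X x r"
    by (auto simp: carrier_pi1)
  have "homotopic_paths X ((p +++ q) +++ r) (p +++ (q +++ r))"
    using pqr by (intro homotopic_paths_sym[OF homotopic_paths_assoc]) (auto simp: loops_at_def)
  then show "a \<otimes>\<^bsub>pi1 X x\<^esub> b \<otimes>\<^bsub>pi1 X x\<^esub> c = a \<otimes>\<^bsub>pi1 X x\<^esub> (b \<otimes>\<^bsub>pi1 X x\<^esub> c)"
    using pqr by (simp add: eq pi1_mult_class join_in_loops_at loop_class_eq_iff)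
next
  fix a assume "a \<in> carrier (pi1 X x)"
  then obtain p where p: "p \<in> loops_at X x" and a: "a = loop_class X x p"
    by (auto simp: carrier_pi1)
  have "homotopic_paths X ((\<lambda>_. x) +++ p) p"
    using p by (intro homotopic_paths_lid_const) (auto simp: loops_at_def)
  then show "\<one>\<^bsub>pi1 X x\<^esub> \<otimes>\<^bsub>pi1 X x\<^esub> a = a"
    using p assms
    by (simp add: a one_pi1 pi1_mult_class const_in_loops_at join_in_loops_at loop_class_eq_iff)
  have "homotopic_paths X (reversepath p +++ reversepath (reversepath p)) (\<lambda>_. x)"
    using p by (intro homotopic_paths_rinv_const) (auto simp: loops_at_def)
  then have "loop_class X x (reversepath p) \<otimes>\<^bsub>pi1 X x\<^esub> a = \<one>\<^bsub>pi1 X x\<^esub>"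
    using p assms by (simp add: a one_pi1 pi1_mult_class reverse_in_loops_at const_in_loops_at
        join_in_loops_at loop_class_eq_iff)
  then show "\<exists>b\<in>carrier (pi1 X x). b \<otimes>\<^bsub>pi1 X x\<^esub> a = \<one>\<^bsub>pi1 X x\<^esub>"
    using p by (auto simp: carrier_pi1 reverse_in_loops_at)
qed

lemma inv_pi1_class:
  assumes "p \<in> loops_at X x"
  shows "inv\<^bsub>pi1 X x\<^esub> loop_class X x p = loop_class X x (reversepath p)"
proof -
  have x: "x \<in> X"
    using assms by (rule loops_at_base)
  have "homotopic_paths X (reversepath p +++ reversepath (reversepath p)) (\<lambda>_. x)"
    using assms by (intro homotopic_paths_rinv_const) (auto simp: loops_at_def)
  then have "loop_class X x (reversepath p) \<otimes>\<^bsub>pi1 X x\<^esub> loop_class X x p = \<one>\<^bsub>pi1 X x\<^esub>"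
    using assms x by (simp add: one_pi1 pi1_mult_class reverse_in_loops_at const_in_loops_at
        join_in_loops_at loop_class_eq_iff)
  then show ?thesis
    using assms by (intro group.inv_equality[OF group_pi1[OF x]])
      (auto simp: carrier_pi1 reverse_in_loops_at)
qed

lemma comp_in_loops_at:
  assumes "continuous_on X f" "f ` X \<subseteq> Y" "p \<in> loops_at X x"
  shows "f \<circ> p \<in> loops_at Y (f x)"
proof -
  have p: "path p" "path_image p \<subseteq> X" "pathstart p = x" "pathfinish p = x"
    using assms(3) by (simp_all add: loops_at_def)
  have "path (f \<circ> p)"
    using p(1,2) assms(1) by (intro path_continuous_image continuous_on_subset[OF assms(1)])
  moreover have "path_image (f \<circ> p) \<subseteq> Y"
    using p(2) assms(2) by (auto simp: path_image_compose)
  ultimately show ?thesis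
    using p(3,4) by (simp add: loops_at_def pathstart_compose pathfinish_compose)
qed

lemma pi1_map_class:
  assumes f: "continuous_on X f" "f ` X \<subseteq> Y" and p: "p \<in> loops_at X x"
  shows "pi1_map f Y (f x) (loop_class X x p) = loop_class Y (f x) (f \<circ> p)"
proof -
  have "loop_class Y (f x) (f \<circ> q) = loop_class Y (f x) (f \<circ> p)" if "q \<in> loop_class X x p" for q
  proof -
    have q: "q \<in> loops_at X x" "homotopic_paths X q p"
      using that p by (auto simp: mem_loop_class intro: homotopic_paths_sym)
    then have "homotopic_paths Y (f \<circ> q) (f \<circ> p)"
      using f by (intro homotopic_paths_continuous_image) auto
    then show ?thesis
      using q p comp_in_loops_at[OF f] by (simp add: loop_class_eq_iff)
  qed
  then show ?thesis
    unfolding pi1_map_def using loop_class_self[OF p] by (intro UN_constant_eq ballI)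
qed

lemma pi1_map_hom:
  assumes f: "continuous_on X f" "f ` X \<subseteq> Y"
  shows "pi1_map f Y (f x) \<in> hom (pi1 X x) (pi1 Y (f x))"
proof (rule homI)
  fix a assume "a \<in> carrier (pi1 X x)"
  then show "pi1_map f Y (f x) a \<in> carrier (pi1 Y (f x))"
    using comp_in_loops_at[OF f] by (auto simp: carrier_pi1 pi1_map_class[OF f])
next
  fix a b assume "a \<in> carrier (pi1 X x)" "b \<in> carrier (pi1 X x)"
  then obtain p q where "p \<in> loops_at X x" "q \<in> loops_at X x"
      "a = loop_class X x p" "b = loop_class X x q"
    by (auto simp: carrier_pi1)
  then show "pi1_map f Y (f x) (a \<otimes>\<^bsub>pi1 X x\<^esub> b) =
      pi1_map f Y (f x) a \<otimes>\<^bsub>pi1 Y (f x)\<^esub> pi1_map f Y (f x) b"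
    using comp_in_loops_at[OF f]
    by (simp add: pi1_map_class[OF f] pi1_mult_class join_in_loops_at path_compose_join)
qed

lemma conj_loop_in_loops_at:
  assumes "\<alpha> \<in> paths_from X x" "\<beta> \<in> loops_at X (pathfinish \<alpha>)"
  shows "\<alpha> +++ \<beta> +++ reversepath \<alpha> \<in> loops_at X x"
  using assms by (simp add: loops_at_def paths_from_def subset_path_image_join path_join_imp)

lemma path_spanier_subgroup:
  assumes x: "x \<in> X" and V: "path_open_cover X x V"
  shows "subgroup (path_spanier X x V) (pi1 X x)"
proof -
  interpret group "pi1 X x"
    by (rule group_pi1[OF x])
  define A where "A = {(\<alpha>, \<beta>). \<alpha> \<in> paths_from X x \<and> \<beta> \<in> loops_at (V \<alpha>) (pathfinish \<alpha>)}"
  have PS: "path_spanier X x V = {loop_class X x (conj_loops x ps) |ps. set ps \<subseteq> A}"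
  proof -
    have "(\<forall>(\<alpha>, \<beta>) \<in> set ps. \<alpha> \<in> paths_from X x \<and> \<beta> \<in> loops_at (V \<alpha>) (pathfinish \<alpha>))
        \<longleftrightarrow> set ps \<subseteq> A" for ps
      unfolding A_def by blast
    then show ?thesis
      unfolding path_spanier_def by simp
  qed
  let ?cl = "loop_class X x" and ?w = "conj_loops x"
  let ?c = "\<lambda>\<alpha> \<beta>. \<alpha> +++ \<beta> +++ reversepath \<alpha>"
  have w_simps: "?w [] = (\<lambda>_. x)" "?w ((\<alpha>, \<beta>) # ps) = ?c \<alpha> \<beta> +++ ?w ps" for \<alpha> \<beta> ps
    by (simp_all add: conj_loops_def)
  have VX: "\<beta> \<in> loops_at X (pathfinish \<alpha>)" if "(\<alpha>, \<beta>) \<in> A" for \<alpha> \<beta>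
    using that V by (fastforce simp: A_def path_open_cover_def loops_at_def dest: openin_imp_subset)
  have c: "?c \<alpha> \<beta> \<in> loops_at X x" if "(\<alpha>, \<beta>) \<in> A" for \<alpha> \<beta>
    using that VX[OF that] by (intro conj_loop_in_loops_at) (auto simp: A_def)
  have w: "?w ps \<in> loops_at X x" if "set ps \<subseteq> A" for ps
    using that
  proof (induction ps)
    case Nil
    then show ?case using x by (simp add: w_simps const_in_loops_at)
  next
    case (Cons ab ps)
    obtain \<alpha> \<beta> where ab: "ab = (\<alpha>, \<beta>)" by (cases ab)
    show ?case
      unfolding ab w_simps using Cons ab by (intro join_in_loops_at c) auto
  qed
  have cl_w: "?cl (?w ps) \<in> carrier (pi1 X x)" if "set ps \<subseteq> A" for ps
    using w[OF that] by (auto simp: carrier_pi1)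
  have cl_c: "?cl (?c \<alpha> \<beta>) \<in> carrier (pi1 X x)" if "(\<alpha>, \<beta>) \<in> A" for \<alpha> \<beta>
    using c[OF that] by (auto simp: carrier_pi1)
  have cl_Cons: "?cl (?w ((\<alpha>, \<beta>) # ps)) = ?cl (?c \<alpha> \<beta>) \<otimes>\<^bsub>pi1 X x\<^esub> ?cl (?w ps)"
    if "(\<alpha>, \<beta>) \<in> A" "set ps \<subseteq> A" for \<alpha> \<beta> ps
    unfolding w_simps using that by (intro pi1_mult_class[symmetric] c w)
  have cl_append: "?cl (?w (ps @ ps')) = ?cl (?w ps) \<otimes>\<^bsub>pi1 X x\<^esub> ?cl (?w ps')"
    if "set ps \<subseteq> A" "set ps' \<subseteq> A" for ps ps'
    using that(1)
  proof (induction ps)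
    case Nil
    then show ?case using cl_w[OF that(2)] by (simp add: w_simps one_pi1[symmetric])
  next
    case (Cons ab ps)
    obtain \<alpha> \<beta> where ab: "ab = (\<alpha>, \<beta>)" by (cases ab)
    show ?case
      using Cons that(2) by (simp add: ab cl_Cons cl_c cl_w m_assoc)
  qed
  have cl_inv: "\<exists>ps'. set ps' \<subseteq> A \<and> inv\<^bsub>pi1 X x\<^esub> ?cl (?w ps) = ?cl (?w ps')"
    if "set ps \<subseteq> A" for ps
    using that
  proof (induction ps)
    case Nil
    then show ?case by (intro exI[of _ "[]"]) (simp add: w_simps one_pi1[symmetric])
  next
    case (Cons ab ps)
    obtain \<alpha> \<beta> where ab: "ab = (\<alpha>, \<beta>)" by (cases ab)
    from Cons obtain ps' where ps': "set ps' \<subseteq> A" "inv\<^bsub>pi1 X x\<^esub> ?cl (?w ps) = ?cl (?w ps')"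
      by auto
    have A: "(\<alpha>, \<beta>) \<in> A" "set ps \<subseteq> A" using Cons ab by auto
    let ?\<beta> = "reversepath \<beta>"
    have A': "(\<alpha>, ?\<beta>) \<in> A"
      using A(1) by (auto simp: A_def reverse_in_loops_at)
    note p = A(1)[unfolded A_def paths_from_def, simplified] VX[OF A(1), unfolded loops_at_def, simplified]
    have "homotopic_paths X (reversepath (?c \<alpha> \<beta>)) (?c \<alpha> ?\<beta>)"
      using p by (simp add: reversepath_joinpaths path_image_reversepath
          homotopic_paths_sym[OF homotopic_paths_assoc])
    then have "?cl (reversepath (?c \<alpha> \<beta>)) = ?cl (?c \<alpha> ?\<beta>)"
      using c[OF A(1)] c[OF A'] by (simp add: loop_class_eq_iff reverse_in_loops_at)
    then have "inv\<^bsub>pi1 X x\<^esub> ?cl (?c \<alpha> \<beta>) = ?cl (?c \<alpha> ?\<beta>)"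
      using c[OF A(1)] by (simp add: inv_pi1_class)
    also have "\<dots> = ?cl (?w [(\<alpha>, ?\<beta>)])"
      using cl_Cons[OF A', of "[]"] cl_c[OF A'] by (simp add: w_simps(1) one_pi1[symmetric])
    finally have "inv\<^bsub>pi1 X x\<^esub> ?cl (?w (ab # ps)) = ?cl (?w (ps' @ [(\<alpha>, ?\<beta>)]))"
      using A A' ps' by (simp add: ab cl_Cons inv_mult_group cl_c cl_w cl_append)
    then show ?case
      using A' ps'(1) by (intro exI[of _ "ps' @ [(\<alpha>, ?\<beta>)]"]) auto
  qed
  show ?thesis
  proof (rule subgroupI)
    show "path_spanier X x V \<subseteq> carrier (pi1 X x)"
      using cl_w by (auto simp: PS)
    show "path_spanier X x V \<noteq> {}"
      by (auto simp: PS intro: exI[of _ "[]"])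
  next
    fix a assume "a \<in> path_spanier X x V"
    then show "inv\<^bsub>pi1 X x\<^esub> a \<in> path_spanier X x V"
      using cl_inv by (force simp: PS)
  next
    fix a b assume "a \<in> path_spanier X x V" "b \<in> path_spanier X x V"
    then obtain ps ps' where "set ps \<subseteq> A" "set ps' \<subseteq> A"
      "a = ?cl (?w ps)" "b = ?cl (?w ps')" by (auto simp: PS)
    then show "a \<otimes>\<^bsub>pi1 X x\<^esub> b \<in> path_spanier X x V"
      unfolding PS by (intro CollectI exI[of _ "ps @ ps'"]) (simp add: cl_append)
  qed
qed

end

theory Submission
  imports Defs
begin

text \<open>A class in the fundamental group of \<open>X\<close> comes from \<open>U\<close> exactly
  when its loop deforms, inside \<open>X\<close>, to a loop lying in \<open>U\<close>
  (\<open>loop_class_in_inclusion_image_iff\<close>). So the inclusion of the path Spanier group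
  says that every product of conjugates
  \<open>\<alpha> +++ \<beta> +++ reversepath \<alpha>\<close>, with \<open>\<beta>\<close> in
  \<open>V \<alpha>\<close>, deforms into \<open>U\<close>. For fixed \<open>U\<close>, the SLT
  condition says the same of single conjugates, with a neighborhood depending on
  \<open>\<alpha>\<close>.

  From single conjugates to products: choose one neighborhood per path to get a path open cover,
  then deform factor by factor, since loops in \<open>U\<close> at the base point are closed under
  concatenation (\<open>conj_loops_homotopic_loop\<close>). From products to single conjugates: a
  conjugate is a product with one factor, so the member of the cover at \<open>\<alpha>\<close> is
  the neighborhood that SLT asks for.\<close>

lemma loops_at_mono: "U \<subseteq> X \<Longrightarrow> loops_at U x \<subseteq> loops_at X x"
  by (auto simp: loops_at_def)

text \<open>The inclusion sends the class in \<open>U\<close> of a loop to the class in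
  \<open>X\<close> of that same loop, so its image consists of the classes in \<open>X\<close> of
  loops lying in \<open>U\<close>; equality of such classes is homotopy in \<open>X\<close>.\<close>

lemma loop_class_in_inclusion_image_iff:
  assumes "U \<subseteq> X" "p \<in> loops_at X x"
  shows "loop_class X x p \<in> pi1_map id X x ` carrier (pi1 U x) \<longleftrightarrow>
    (\<exists>\<gamma>\<in>loops_at U x. homotopic_paths X \<gamma> p)"
proof -
  have "pi1_map id X x (loop_class U x \<gamma>) = loop_class X x \<gamma>" if "\<gamma> \<in> loops_at U x" for \<gamma>
    using pi1_map_class[of U id X \<gamma> x] that assms(1) by simp
  then have "pi1_map id X x ` carrier (pi1 U x) = loop_class X x ` loops_at U x"
    by (simp add: carrier_pi1 image_image)
  moreover have "loop_class X x p = loop_class X x \<gamma> \<longleftrightarrow> homotopic_paths X \<gamma> p"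
    if "\<gamma> \<in> loops_at U x" for \<gamma>
    using loop_class_eq_iff[of \<gamma> X x p] that assms loops_at_mono[OF assms(1)] by auto
  ultimately show ?thesis
    by (auto simp: image_iff)
qed

lemma conj_loops_Nil: "conj_loops x [] = (\<lambda>_. x)"
  by (simp add: conj_loops_def)

lemma conj_loops_Cons:
  "conj_loops x ((\<alpha>, \<beta>) # ps) = (\<alpha> +++ \<beta> +++ reversepath \<alpha>) +++ conj_loops x ps"
  by (simp add: conj_loops_def)

text \<open>Induction on the factors: the deformed first factor and the deformed remainder are loops
  in \<open>U\<close> with a common base point, so they and their homotopies concatenate. The
  homotopies may leave \<open>U\<close>; only the resulting loop must lie there. The empty product
  is the constant loop, already in \<open>U\<close>.\<close>

lemma conj_loops_homotopic_loop:
  assumes "x \<in> U"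
    and "\<And>\<alpha> \<beta>. (\<alpha>, \<beta>) \<in> set ps \<Longrightarrow>
      \<exists>\<gamma>\<in>loops_at U x. homotopic_paths X \<gamma> (\<alpha> +++ \<beta> +++ reversepath \<alpha>)"
    and "U \<subseteq> X"
  shows "\<exists>\<gamma>\<in>loops_at U x. homotopic_paths X \<gamma> (conj_loops x ps)"
  using assms(2)
proof (induction ps)
  case Nil
  have "homotopic_paths X (\<lambda>_. x) (\<lambda>_. x)"
    using const_in_loops_at[of x X] assms by (auto simp: loops_at_def)
  then show ?case
    unfolding conj_loops_Nil using const_in_loops_at[OF assms(1)] by blast
next
  case (Cons ab ps)
  obtain \<alpha> \<beta> where ab: "ab = (\<alpha>, \<beta>)"
    by (cases ab)
  obtain \<gamma> where \<gamma>: "\<gamma> \<in> loops_at U x" "homotopic_paths X \<gamma> (\<alpha> +++ \<beta> +++ reversepath \<alpha>)"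
    using Cons.prems[of \<alpha> \<beta>] ab by auto
  obtain \<delta> where \<delta>: "\<delta> \<in> loops_at U x" "homotopic_paths X \<delta> (conj_loops x ps)"
    using Cons by auto
  have "pathfinish \<gamma> = pathstart \<delta>"
    using \<gamma>(1) \<delta>(1) by (simp add: loops_at_def)
  then have "homotopic_paths X (\<gamma> +++ \<delta>) (conj_loops x (ab # ps))"
    unfolding ab conj_loops_Cons using \<gamma>(2) \<delta>(2) by (intro homotopic_paths_join)
  then show ?case
    using join_in_loops_at[OF \<gamma>(1) \<delta>(1)] by blast
qed

text \<open>This lets the membership criterion for the image of the inclusion be applied to the
  products.\<close>

lemma conj_loops_in_loops_at:
  assumes "x \<in> X"
    and "\<And>\<alpha> \<beta>. (\<alpha>, \<beta>) \<in> set ps \<Longrightarrow> \<alpha> \<in> paths_from X x \<and> \<beta> \<in> loops_at X (pathfinish \<alpha>)"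
  shows "conj_loops x ps \<in> loops_at X x"
  using assms(2)
proof (induction ps)
  case Nil
  then show ?case
    using assms(1) by (simp add: conj_loops_Nil const_in_loops_at)
next
  case (Cons ab ps)
  obtain \<alpha> \<beta> where ab: "ab = (\<alpha>, \<beta>)"
    by (cases ab)
  have "\<alpha> +++ \<beta> +++ reversepath \<alpha> \<in> loops_at X x"
    using Cons.prems[of \<alpha> \<beta>] ab by (intro conj_loop_in_loops_at) auto
  moreover have "conj_loops x ps \<in> loops_at X x"
    using Cons by auto
  ultimately show ?case
    unfolding ab conj_loops_Cons by (rule join_in_loops_at)
qed

theorem proposition2p3:
  fixes X :: "'a::topological_space set" and x0 :: 'a
  assumes "x0 \<in> X"
  shows "SLT_at X x0 \<longleftrightarrow>
    (\<forall>U. openin (top_of_set X) U \<and> x0 \<in> U \<longrightarrow>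
      (\<exists>V. path_open_cover X x0 V \<and>
        path_spanier X x0 V \<subseteq> pi1_map id X x0 ` carrier (pi1 U x0)))"
    (is "_ \<longleftrightarrow> ?R")
proof
  assume SLT: "SLT_at X x0"
  show ?R
  proof (intro allI impI, elim conjE)
    fix U assume U: "openin (top_of_set X) U" "x0 \<in> U"
    have UX: "U \<subseteq> X"
      using U(1) by (rule openin_imp_subset)
    \<comment> \<open>Every path considered starts at \<open>x0\<close>, so the single neighborhood
      \<open>U\<close> can be fed into the SLT condition of all of them.\<close>
    have "\<forall>\<alpha>\<in>paths_from X x0. \<exists>V. openin (top_of_set X) V \<and> pathfinish \<alpha> \<in> V \<and>
        (\<forall>\<beta>\<in>loops_at V (pathfinish \<alpha>). \<exists>\<gamma>\<in>loops_at U x0.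
          homotopic_paths X \<gamma> (\<alpha> +++ \<beta> +++ reversepath \<alpha>))"
    proof
      fix \<alpha> assume \<alpha>: "\<alpha> \<in> paths_from X x0"
      then have "pathstart \<alpha> = x0"
        by (simp add: paths_from_def)
      moreover have "SLT_path X \<alpha>"
        using SLT \<alpha> by (simp add: SLT_at_def)
      ultimately show "\<exists>V. openin (top_of_set X) V \<and> pathfinish \<alpha> \<in> V \<and>
        (\<forall>\<beta>\<in>loops_at V (pathfinish \<alpha>). \<exists>\<gamma>\<in>loops_at U x0.
          homotopic_paths X \<gamma> (\<alpha> +++ \<beta> +++ reversepath \<alpha>))"
        using U by (simp add: SLT_path_def)
    qed
    \<comment> \<open>Choice selects these neighborhoods for all paths at once; the resulting family
      is the cover.\<close>
    from bchoice[OF this] obtain V where V: "\<And>\<alpha>. \<alpha> \<in> paths_from X x0 \<Longrightarrow>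
        openin (top_of_set X) (V \<alpha>) \<and> pathfinish \<alpha> \<in> V \<alpha> \<and>
        (\<forall>\<beta>\<in>loops_at (V \<alpha>) (pathfinish \<alpha>). \<exists>\<gamma>\<in>loops_at U x0.
          homotopic_paths X \<gamma> (\<alpha> +++ \<beta> +++ reversepath \<alpha>))"
      by blast
    have "loop_class X x0 (conj_loops x0 ps) \<in> pi1_map id X x0 ` carrier (pi1 U x0)"
      if ps: "\<forall>(\<alpha>, \<beta>)\<in>set ps. \<alpha> \<in> paths_from X x0 \<and> \<beta> \<in> loops_at (V \<alpha>) (pathfinish \<alpha>)" for ps
    proof -
      have "\<beta> \<in> loops_at X (pathfinish \<alpha>)"
        if "\<alpha> \<in> paths_from X x0" "\<beta> \<in> loops_at (V \<alpha>) (pathfinish \<alpha>)" for \<alpha> \<beta>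
        using that(2) V[OF that(1)] loops_at_mono[OF openin_imp_subset] by blast
      then have "conj_loops x0 ps \<in> loops_at X x0"
        using ps assms by (intro conj_loops_in_loops_at) auto
      moreover have "\<exists>\<gamma>\<in>loops_at U x0. homotopic_paths X \<gamma> (conj_loops x0 ps)"
      proof (rule conj_loops_homotopic_loop[OF U(2) _ UX])
        fix \<alpha> \<beta> assume "(\<alpha>, \<beta>) \<in> set ps"
        then have "\<alpha> \<in> paths_from X x0" "\<beta> \<in> loops_at (V \<alpha>) (pathfinish \<alpha>)"
          using ps by auto
        then show "\<exists>\<gamma>\<in>loops_at U x0. homotopic_paths X \<gamma> (\<alpha> +++ \<beta> +++ reversepath \<alpha>)"
          using V by simp
      qed
      ultimately show ?thesis
        by (simp add: loop_class_in_inclusion_image_iff[OF UX])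
    qed
    then have "path_spanier X x0 V \<subseteq> pi1_map id X x0 ` carrier (pi1 U x0)"
      unfolding path_spanier_def by blast
    moreover have "path_open_cover X x0 V"
      using V by (simp add: path_open_cover_def)
    ultimately show "\<exists>V. path_open_cover X x0 V \<and>
        path_spanier X x0 V \<subseteq> pi1_map id X x0 ` carrier (pi1 U x0)"
      by blast
  qed
next
  assume R: ?R
  show "SLT_at X x0"
    unfolding SLT_at_def
  proof
    fix \<alpha> assume \<alpha>: "\<alpha> \<in> paths_from X x0"
    have "\<exists>V. openin (top_of_set X) V \<and> pathfinish \<alpha> \<in> V \<and>
        (\<forall>\<beta>\<in>loops_at V (pathfinish \<alpha>). \<exists>\<gamma>\<in>loops_at U x0.
          homotopic_paths X \<gamma> (\<alpha> +++ \<beta> +++ reversepath \<alpha>))"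
      if U: "openin (top_of_set X) U" "x0 \<in> U" for U
    proof -
      \<comment> \<open>The cover depends on \<open>U\<close>, which is harmless: in the SLT
        condition too the neighborhood of the endpoint is chosen after \<open>U\<close>.\<close>
      obtain V where V: "path_open_cover X x0 V"
        and sub: "path_spanier X x0 V \<subseteq> pi1_map id X x0 ` carrier (pi1 U x0)"
        using R U by blast
      have V\<alpha>: "openin (top_of_set X) (V \<alpha>)" "pathfinish \<alpha> \<in> V \<alpha>"
        using V \<alpha> by (auto simp: path_open_cover_def)
      have "\<exists>\<gamma>\<in>loops_at U x0. homotopic_paths X \<gamma> (\<alpha> +++ \<beta> +++ reversepath \<alpha>)"
        if \<beta>: "\<beta> \<in> loops_at (V \<alpha>) (pathfinish \<alpha>)" for \<beta>
      proof -
        let ?c = "\<alpha> +++ \<beta> +++ reversepath \<alpha>"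
        have "\<beta> \<in> loops_at X (pathfinish \<alpha>)"
          using \<beta> loops_at_mono[OF openin_imp_subset[OF V\<alpha>(1)]] by blast
        then have c: "?c \<in> loops_at X x0"
          using \<alpha> by (intro conj_loop_in_loops_at)
        have w: "conj_loops x0 [(\<alpha>, \<beta>)] \<in> loops_at X x0"
          using c assms by (simp add: conj_loops_Cons conj_loops_Nil join_in_loops_at const_in_loops_at)
        \<comment> \<open>The generator with the single factor given by \<open>\<alpha>\<close> and
          \<open>\<beta>\<close> is all that is needed from the path Spanier group.\<close>
        have "loop_class X x0 (conj_loops x0 [(\<alpha>, \<beta>)]) \<in> path_spanier X x0 V"
          unfolding path_spanier_def using \<alpha> \<beta> by (intro CollectI exI[of _ "[(\<alpha>, \<beta>)]"]) simp
        then obtain \<gamma> where "\<gamma> \<in> loops_at U x0" "homotopic_paths X \<gamma> (conj_loops x0 [(\<alpha>, \<beta>)])"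
          using sub loop_class_in_inclusion_image_iff[OF openin_imp_subset[OF U(1)] w] by blast
        \<comment> \<open>A one-factor product still ends in the constant loop that closes
          \<open>conj_loops\<close>; the right identity law removes it.\<close>
        moreover have "homotopic_paths X (conj_loops x0 [(\<alpha>, \<beta>)]) ?c"
          unfolding conj_loops_Cons conj_loops_Nil
          using c by (intro homotopic_paths_rid_const) (auto simp: loops_at_def)
        ultimately show ?thesis
          using homotopic_paths_trans by blast
      qed
      then show ?thesis
        using V\<alpha> by blast
    qed
    then show "SLT_path X \<alpha>"
      using \<alpha> by (simp add: SLT_path_def paths_from_def)
  qed
qed

end
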